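(* Let $\mathcal X$ be a finite metric space with metric $d$ taking values in $\{0,1,\dots,n\}$, $n=\operatorname{diam}(\mathcal X)$, such that $|B(x,t)|$ does not depend on $x$. Let $Z=\{z_1,\dots,z_N\}\subset\mathcal X$, let $g_0,\dots,g_n\ge0$, and $\gamma(t)=\sum_{i=t}^n g_i$. Then $$D_G^{L_2}(Z)=\langle\lambda_G\rangle_{\mathcal X}-\langle\lambda_G\rangle_Z,$$ where $\lambda_G(x,y)=\frac12\sum_{z\in\mathcal X}|\gamma(d(x,z))-\gamma(d(y,z))|$, $\langle\lambda_G\rangle_{\mathcal X}=\frac1{|\mathcal X|^2}\sum_{x,y\in\mathcal X}\lambda_G(x,y)$ and $\langle\lambda_G\rangle_Z=\frac1{N^2}\sum_{i,j=1}^N\lambda_G(z_i,z_j)$.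
   Context: $B(x,t)=\{y\in\mathcal X:d(x,y)\le t\}$. $D_G^{L_2}(Z)=\sum_{t=0}^n g_tD_t(Z)^2$ with $D_t(Z)^2=\sum_{x\in\mathcal X}\Big(\frac1N\sum_{j=1}^N\mathbb 1_{B(x,t)}(z_j)-\frac{|B(x,t)|}{|\mathcal X|}\Big)^2$. *)

theory Defs
  imports "HOL-Analysis.Analysis"
begin

text \<open>
  A finite metric space with integer distances is a finite carrier \<open>X\<close> with a distance
  \<open>d :: 'a \<Rightarrow> 'a \<Rightarrow> nat\<close> such that \<open>Metric_space X (\<lambda>x y. real (d x y))\<close> holds.
  The point set is an enumeration \<open>z 1, \<dots>, z N\<close>; points may be repeated.
\<close>

definition diam :: "'a set \<Rightarrow> ('a \<Rightarrow> 'a \<Rightarrow> nat) \<Rightarrow> nat"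
  where "diam X d = Max {d x y | x y. x \<in> X \<and> y \<in> X}"

definition nball :: "'a set \<Rightarrow> ('a \<Rightarrow> 'a \<Rightarrow> nat) \<Rightarrow> 'a \<Rightarrow> nat \<Rightarrow> 'a set"
  where "nball X d x t = {y \<in> X. d x y \<le> t}"

lemma nball_eq_mcball:
  assumes "Metric_space X (\<lambda>x y. real (d x y))" "x \<in> X"
  shows "nball X d x t = Metric_space.mcball X (\<lambda>x y. real (d x y)) x (real t)"
  using assms by (auto simp: nball_def Metric_space.mcball_def)

definition disc_sq ::
  "'a set \<Rightarrow> ('a \<Rightarrow> 'a \<Rightarrow> nat) \<Rightarrow> nat \<Rightarrow> (nat \<Rightarrow> 'a) \<Rightarrow> nat \<Rightarrow> real"
  where "disc_sq X d N z t =
    (\<Sum>x\<in>X. (1 / real N * (\<Sum>j=1..N. indicator (nball X d x t) (z j))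
              - real (card (nball X d x t)) / real (card X))\<^sup>2)"

definition disc_L2 ::
  "'a set \<Rightarrow> ('a \<Rightarrow> 'a \<Rightarrow> nat) \<Rightarrow> nat \<Rightarrow> (nat \<Rightarrow> real) \<Rightarrow> nat \<Rightarrow> (nat \<Rightarrow> 'a) \<Rightarrow> real"
  where "disc_L2 X d n g N z = (\<Sum>t=0..n. g t * disc_sq X d N z t)"

definition gam :: "nat \<Rightarrow> (nat \<Rightarrow> real) \<Rightarrow> nat \<Rightarrow> real"
  where "gam n g t = (\<Sum>i=t..n. g i)"

definition lam ::
  "'a set \<Rightarrow> ('a \<Rightarrow> 'a \<Rightarrow> nat) \<Rightarrow> nat \<Rightarrow> (nat \<Rightarrow> real) \<Rightarrow> 'a \<Rightarrow> 'a \<Rightarrow> real"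
  where "lam X d n g x y =
    1 / 2 * (\<Sum>u\<in>X. \<bar>gam n g (d x u) - gam n g (d y u)\<bar>)"

definition avg_space :: "'a set \<Rightarrow> ('a \<Rightarrow> 'a \<Rightarrow> real) \<Rightarrow> real"
  where "avg_space X f = 1 / (real (card X))\<^sup>2 * (\<Sum>x\<in>X. \<Sum>y\<in>X. f x y)"

definition avg_points :: "nat \<Rightarrow> (nat \<Rightarrow> 'a) \<Rightarrow> ('a \<Rightarrow> 'a \<Rightarrow> real) \<Rightarrow> real"
  where "avg_points N z f = 1 / (real N)\<^sup>2 * (\<Sum>i=1..N. \<Sum>j=1..N. f (z i) (z j))"

end

theory Submission
  imports Defs
begin

text \<open>
  Write \<open>\<gamma>(s) = \<Sum>t. g\<^sub>t [s \<le> t]\<close>. For fixed \<open>s, s'\<close> the differences \<open>[s \<le> t] - [s' \<le> t]\<close> all have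
  the same sign, so the absolute value in \<open>\<lambda>\<close> can be taken inside the sum over \<open>t\<close>, where it equals
  \<open>[s \<le> t] + [s' \<le> t] - 2 [s \<le> t] [s' \<le> t]\<close>. Hence \<open>\<lambda>(x,y) = \<Sum>t. g\<^sub>t (b\<^sub>t - |B(x,t) \<inter> B(y,t)|)\<close>,
  where \<open>b\<^sub>t\<close> is the common size of the balls of radius \<open>t\<close>. The mean of \<open>\<lambda>\<close> over any finite family
  is then \<open>\<Sum>t. g\<^sub>t (b\<^sub>t - \<Sum>u. f\<^sub>t(u)\<^sup>2)\<close>, with \<open>f\<^sub>t(u)\<close> the fraction of the family lying in \<open>B(u,t)\<close>.
  For the whole space \<open>f\<^sub>t\<close> is the constant \<open>b\<^sub>t/|X|\<close>, which is also the mean over \<open>u\<close> of \<open>f\<^sub>t(u)\<close> for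
  the given point set, so the difference of the two means is a sum of variances.
\<close>

text \<open>Indicators put all values of \<open>gam\<close> on one index range, so that sums over
  points can be treated one \<open>t\<close> at a time.\<close>

lemma gam_eq_sum_of_bool: "gam n g s = (\<Sum>t=0..n. g t * of_bool (s \<le> t))"
  unfolding gam_def by (rule sum.mono_neutral_cong_left) auto

lemma abs_gam_diff:
  assumes "\<And>i. i \<in> {0..n} \<Longrightarrow> g i \<ge> 0"
  shows "\<bar>gam n g s - gam n g s'\<bar>
    = (\<Sum>t=0..n. g t * (of_bool (s \<le> t) + of_bool (s' \<le> t) - 2 * of_bool (s \<le> t) * of_bool (s' \<le> t)))"
proof -
  have le: "\<bar>gam n g s - gam n g s'\<bar>
    = (\<Sum>t=0..n. g t * (of_bool (s \<le> t) + of_bool (s' \<le> t) - 2 * of_bool (s \<le> t) * of_bool (s' \<le> t)))"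
    if "s \<le> s'" for s s'
  proof -
    have diff: "gam n g s - gam n g s' = (\<Sum>t=0..n. g t * (of_bool (s \<le> t) - of_bool (s' \<le> t)))"
      by (simp add: gam_eq_sum_of_bool sum_subtractf right_diff_distrib)
    moreover have "\<dots> \<ge> 0"
      using assms that by (intro sum_nonneg mult_nonneg_nonneg) auto
    \<comment> \<open>For \<open>s \<le> s'\<close> the product of the two indicators is the
      indicator of \<open>s' \<le> t\<close>, so the symmetric expression collapses to the plain
      difference.\<close>
    moreover have "\<dots> = (\<Sum>t=0..n. g t *
        (of_bool (s \<le> t) + of_bool (s' \<le> t) - 2 * of_bool (s \<le> t) * of_bool (s' \<le> t)))"
      using that by (intro sum.cong) auto
    ultimately show ?thesis by simp
  qed
  show ?thesis
  proof (cases "s \<le> s'")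
    case False
    then show ?thesis
      using le[of s' s] by (simp add: abs_minus_commute add.commute mult.commute mult.left_commute)
  qed (rule le)
qed

lemma card_nball_eq_sum:
  assumes "finite X"
  shows "real (card (nball X d x t)) = (\<Sum>u\<in>X. of_bool (d x u \<le> t))"
  using assms by (simp add: nball_def Int_def flip: sum.inter_filter)

lemma lam_eq_sum_ball_overlap:
  assumes "finite X" "x \<in> X" "y \<in> X"
    and b: "\<And>t x. t \<in> {0..n} \<Longrightarrow> x \<in> X \<Longrightarrow> real (card (nball X d x t)) = b t"
    and g: "\<And>i. i \<in> {0..n} \<Longrightarrow> g i \<ge> 0"
  shows "lam X d n g x y
    = (\<Sum>t=0..n. g t * (b t - (\<Sum>u\<in>X. of_bool (d x u \<le> t) * of_bool (d y u \<le> t))))"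
proof -
  have "lam X d n g x y = 1 / 2 * (\<Sum>u\<in>X. \<Sum>t=0..n. g t * (of_bool (d x u \<le> t) + of_bool (d y u \<le> t)
      - 2 * of_bool (d x u \<le> t) * of_bool (d y u \<le> t)))"
    unfolding lam_def using g by (intro arg_cong2[where f = "(*)"] sum.cong refl abs_gam_diff)
  also have "\<dots> = (\<Sum>t=0..n. g t * ((\<Sum>u\<in>X. of_bool (d x u \<le> t)) / 2 + (\<Sum>u\<in>X. of_bool (d y u \<le> t)) / 2
      - (\<Sum>u\<in>X. of_bool (d x u \<le> t) * of_bool (d y u \<le> t))))"
    by (subst sum.swap)
       (simp add: sum_distrib_left sum_divide_distrib sum.distrib[symmetric] sum_subtractf[symmetric]
         algebra_simps add_divide_distrib diff_divide_distrib del: sum_of_bool_eq)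
  \<comment> \<open>Both linear sums are sizes of balls of radius \<open>t\<close>, so the two
    halves add up to \<open>b t\<close>.\<close>
  also have "\<dots> = (\<Sum>t=0..n. g t * (b t - (\<Sum>u\<in>X. of_bool (d x u \<le> t) * of_bool (d y u \<le> t))))"
  proof (rule sum.cong)
    fix t assume "t \<in> {0..n}"
    then show "g t * ((\<Sum>u\<in>X. of_bool (d x u \<le> t)) / 2 + (\<Sum>u\<in>X. of_bool (d y u \<le> t)) / 2
        - (\<Sum>u\<in>X. of_bool (d x u \<le> t) * of_bool (d y u \<le> t)))
      = g t * (b t - (\<Sum>u\<in>X. of_bool (d x u \<le> t) * of_bool (d y u \<le> t)))"
      using b[of t x] b[of t y] assms(2,3)
      by (simp add: card_nball_eq_sum[OF \<open>finite X\<close>] del: sum_of_bool_eq)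
  qed simp
  finally show ?thesis .
qed

text \<open>An indexed family covers both averages: the space, with \<open>z\<close> the identity on
  \<open>X\<close>, and the point set, where repetitions must count.\<close>

lemma mean_lam:
  assumes "finite X" "finite I" "I \<noteq> {}" and z: "\<And>i. i \<in> I \<Longrightarrow> z i \<in> X"
    and b: "\<And>t x. t \<in> {0..n} \<Longrightarrow> x \<in> X \<Longrightarrow> real (card (nball X d x t)) = b t"
    and g: "\<And>i. i \<in> {0..n} \<Longrightarrow> g i \<ge> 0"
  shows "1 / (real (card I))\<^sup>2 * (\<Sum>i\<in>I. \<Sum>j\<in>I. lam X d n g (z i) (z j))
    = (\<Sum>t=0..n. g t * (b t - (\<Sum>u\<in>X. ((\<Sum>i\<in>I. of_bool (d (z i) u \<le> t)) / real (card I))\<^sup>2)))"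
proof -
  let ?c = "real (card I)"
  let ?K = "\<lambda>t i j. \<Sum>u\<in>X. of_bool (d (z i) u \<le> t) * of_bool (d (z j) u \<le> t) :: real"
  have c: "?c \<noteq> 0"
    using assms by simp
  \<comment> \<open>With the sum over \<open>u\<close> outermost, the double sum over
    \<open>i\<close> and \<open>j\<close> factors into a square.\<close>
  have sq: "(\<Sum>i\<in>I. \<Sum>j\<in>I. ?K t i j) = (\<Sum>u\<in>X. (\<Sum>i\<in>I. of_bool (d (z i) u \<le> t))\<^sup>2)" for t
  proof -
    have "(\<Sum>i\<in>I. \<Sum>j\<in>I. ?K t i j)
        = (\<Sum>i\<in>I. \<Sum>u\<in>X. \<Sum>j\<in>I. of_bool (d (z i) u \<le> t) * of_bool (d (z j) u \<le> t))"
      by (intro sum.cong refl) (rule sum.swap)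
    also have "\<dots> = (\<Sum>u\<in>X. \<Sum>i\<in>I. \<Sum>j\<in>I. of_bool (d (z i) u \<le> t) * of_bool (d (z j) u \<le> t))"
      by (rule sum.swap)
    finally show ?thesis
      by (simp only: power2_eq_square sum_product)
  qed
  have "(\<Sum>i\<in>I. \<Sum>j\<in>I. lam X d n g (z i) (z j))
      = (\<Sum>i\<in>I. \<Sum>j\<in>I. \<Sum>t=0..n. g t * (b t - ?K t i j))"
    using z by (intro sum.cong refl lam_eq_sum_ball_overlap[OF \<open>finite X\<close> _ _ b g]) auto
  also have "\<dots> = (\<Sum>i\<in>I. \<Sum>t=0..n. \<Sum>j\<in>I. g t * (b t - ?K t i j))"
    by (intro sum.cong refl) (rule sum.swap)
  also have "\<dots> = (\<Sum>t=0..n. \<Sum>i\<in>I. \<Sum>j\<in>I. g t * (b t - ?K t i j))"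
    by (rule sum.swap)
  also have "\<dots> = (\<Sum>t=0..n. g t * (?c\<^sup>2 * b t - (\<Sum>i\<in>I. \<Sum>j\<in>I. ?K t i j)))"
    by (simp only: sum_distrib_left[symmetric] sum_subtractf sum_constant power2_eq_square mult.assoc)
  also have "\<dots> = (\<Sum>t=0..n. g t * (?c\<^sup>2 * b t - (\<Sum>u\<in>X. (\<Sum>i\<in>I. of_bool (d (z i) u \<le> t))\<^sup>2)))"
    by (simp only: sq)
  finally have "1 / ?c\<^sup>2 * (\<Sum>i\<in>I. \<Sum>j\<in>I. lam X d n g (z i) (z j))
      = (\<Sum>t=0..n. g t * (b t - (\<Sum>u\<in>X. (\<Sum>i\<in>I. of_bool (d (z i) u \<le> t))\<^sup>2) / ?c\<^sup>2))"
    using c by (simp add: sum_distrib_left field_simps del: sum_of_bool_eq)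
  then show ?thesis
    by (simp only: power_divide sum_divide_distrib[symmetric])
qed

text \<open>This is the variance identity. The sum of the constant \<open>m\<^sup>2\<close> is left
  unevaluated to match the term coming from the whole space.\<close>

lemma sum_power2_diff_mean:
  fixes f :: "'a \<Rightarrow> real"
  assumes "sum f X = real (card X) * m"
  shows "(\<Sum>x\<in>X. (f x - m)\<^sup>2) = (\<Sum>x\<in>X. (f x)\<^sup>2) - (\<Sum>x\<in>X. m\<^sup>2)"
proof -
  have "(\<Sum>x\<in>X. (f x - m)\<^sup>2) = (\<Sum>x\<in>X. (f x)\<^sup>2) + (\<Sum>x\<in>X. m\<^sup>2) - 2 * m * sum f X"
    by (simp add: power2_diff sum.distrib sum_subtractf mult_ac flip: sum_distrib_left sum_distrib_right)
  then show ?thesis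
    using assms by (simp add: power2_eq_square)
qed

theorem theorem6p1:
  fixes X :: "'a set" and d :: "'a \<Rightarrow> 'a \<Rightarrow> nat" and n N :: nat
    and z :: "nat \<Rightarrow> 'a" and g :: "nat \<Rightarrow> real"
  assumes "finite X"
    and "Metric_space X (\<lambda>x y. real (d x y))"
    and "\<And>x y. x \<in> X \<Longrightarrow> y \<in> X \<Longrightarrow> d x y \<in> {0..n}"
    and "n = diam X d"
    and "\<And>t x y. t \<in> {0..n} \<Longrightarrow> x \<in> X \<Longrightarrow> y \<in> X \<Longrightarrow> card (nball X d x t) = card (nball X d y t)"
    and "N \<ge> 1"
    and "\<And>j. j \<in> {1..N} \<Longrightarrow> z j \<in> X"
    and "\<And>i. i \<in> {0..n} \<Longrightarrow> g i \<ge> 0"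
  shows "disc_L2 X d n g N z = avg_space X (lam X d n g) - avg_points N z (lam X d n g)"
proof -
  note fin = assms(1) and z = assms(7) and g = assms(8)
  have ne: "X \<noteq> {}"
    using z[of 1] \<open>N \<ge> 1\<close> by auto
  have comm: "d x y = d y x" for x y
    using Metric_space.commute[OF assms(2), of x y] by simp
  \<comment> \<open>Any centre in \<open>X\<close> would do; \<open>z 1\<close> is one because
    \<open>N \<ge> 1\<close>.\<close>
  define b where "b t = real (card (nball X d (z 1) t))" for t
  have b: "real (card (nball X d x t)) = b t" if "t \<in> {0..n}" "x \<in> X" for t x
    unfolding b_def using assms(5)[OF that, of "z 1"] z[of 1] \<open>N \<ge> 1\<close> by simp
  have ball: "(\<Sum>u\<in>X. of_bool (d x u \<le> t)) = b t" if "t \<in> {0..n}" "x \<in> X" for t x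
    using b[OF that] by (simp only: card_nball_eq_sum[OF fin])
  define f where "f t u = (\<Sum>i\<in>{1..N}. of_bool (d (z i) u \<le> t)) / real N" for t u
  have points: "avg_points N z (lam X d n g) = (\<Sum>t=0..n. g t * (b t - (\<Sum>u\<in>X. (f t u)\<^sup>2)))"
    using mean_lam[OF fin _ _ z b g, of "{1..N}"] \<open>N \<ge> 1\<close>
    by (simp add: avg_points_def f_def del: sum_of_bool_eq)
  have "avg_space X (lam X d n g)
      = (\<Sum>t=0..n. g t * (b t - (\<Sum>u\<in>X. ((\<Sum>i\<in>X. of_bool (d i u \<le> t)) / real (card X))\<^sup>2)))"
    unfolding avg_space_def by (rule mean_lam[OF fin fin ne _ b g, where z = "\<lambda>x. x"])
  also have "\<dots> = (\<Sum>t=0..n. g t * (b t - (\<Sum>u\<in>X. (b t / real (card X))\<^sup>2)))"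
  \<comment> \<open>By symmetry of \<open>d\<close>, the points whose ball contains \<open>u\<close>
    are the points of the ball around \<open>u\<close>.\<close>
  proof (intro sum.cong refl arg_cong2[where f = "(*)"] arg_cong2[where f = "(-)"])
    fix t u assume "t \<in> {0..n}" "u \<in> X"
    then show "((\<Sum>i\<in>X. of_bool (d i u \<le> t)) / real (card X))\<^sup>2 = (b t / real (card X))\<^sup>2"
      using ball by (simp only: comm[of _ u])
  qed
  finally have space: "avg_space X (lam X d n g)
      = (\<Sum>t=0..n. g t * (b t - (\<Sum>u\<in>X. (b t / real (card X))\<^sup>2)))" .
  have disc: "disc_sq X d N z t = (\<Sum>u\<in>X. (f t u)\<^sup>2) - (\<Sum>u\<in>X. (b t / real (card X))\<^sup>2)"
    if t: "t \<in> {0..n}" for t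
  proof -
    \<comment> \<open>Double counting: each \<open>z i\<close> lies within distance \<open>t\<close>
      of exactly \<open>b t\<close> centres \<open>u\<close>.\<close>
    have "(\<Sum>u\<in>X. f t u) = (\<Sum>i\<in>{1..N}. \<Sum>u\<in>X. of_bool (d (z i) u \<le> t)) / real N"
      unfolding f_def sum_divide_distrib[symmetric] by (subst sum.swap) (rule refl)
    also have "\<dots> = (\<Sum>i\<in>{1..N}. b t) / real N"
      by (intro arg_cong2[where f = "(/)"] sum.cong refl ball[OF t] z)
    also have "\<dots> = real (card X) * (b t / real (card X))"
      using \<open>N \<ge> 1\<close> fin ne by simp
    finally have mean: "(\<Sum>u\<in>X. f t u) = real (card X) * (b t / real (card X))" .
    have "disc_sq X d N z t = (\<Sum>x\<in>X. (f t x - b t / real (card X))\<^sup>2)"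
      unfolding disc_sq_def
    proof (rule sum.cong)
      fix x assume x: "x \<in> X"
      have "(\<Sum>j=1..N. indicator (nball X d x t) (z j)) = (\<Sum>i\<in>{1..N}. of_bool (d (z i) x \<le> t) :: real)"
        using z by (intro sum.cong refl) (auto simp: nball_def indicator_def comm[of x])
      then show "(1 / real N * (\<Sum>j=1..N. indicator (nball X d x t) (z j))
          - real (card (nball X d x t)) / real (card X))\<^sup>2 = (f t x - b t / real (card X))\<^sup>2"
        unfolding f_def b[OF t x] by (simp del: sum_of_bool_eq)
    qed simp
    then show ?thesis
      using sum_power2_diff_mean[OF mean] by simp
  qed
  \<comment> \<open>For each \<open>t\<close> the two terms \<open>g t * b t\<close> cancel and
    leave the variance \<open>disc_sq X d N z t\<close> weighted by \<open>g t\<close>.\<close>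
  have "disc_L2 X d n g N z = (\<Sum>t=0..n. g t * (b t - (\<Sum>u\<in>X. (b t / real (card X))\<^sup>2))
      - g t * (b t - (\<Sum>u\<in>X. (f t u)\<^sup>2)))"
    unfolding disc_L2_def by (intro sum.cong refl) (simp add: disc right_diff_distrib del: sum_constant)
  then show ?thesis
    by (simp only: space points sum_subtractf)
qed

end
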